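(* The following assertion (conjectured by Vempala) is false: there is an absolute constant $C>0$ such that for all integers $N\ge k$ with $N \geq 2$, for the complete bipartite graph with sides $U,V$, $|U|=N$, $|V|=k$, and for every partition $\mathcal{P}$ of its edge set, $$\sum_{i\in U,\ j\in V}\min\Big(1,\ \sum_{p\in\mathcal{P}}\frac{p_i\,p_j}{|p|}\Big)\ \ge\ C\,\frac{Nk}{\log N}.$$ Moreover, it fails already when restricted to $N=k$.
   Context: For a part $p\in\mathcal P$ (a nonempty set of edges), $|p|$ denotes the number of edges in $p$, and for a vertex $i\in U\cup V$, $p_i$ denotes the number of edges of $p$ incident to $i$. *)

theory Defs
  imports Complex_Main "HOL-Library.Disjoint_Sets"
begin

text \<open>Graphs are simple and undirected: an edge is the two-element set of its end points.\<close>

definition complete_bipartite_edges :: "'a set \<Rightarrow> 'a set \<Rightarrow> 'a set set" where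
  "complete_bipartite_edges U V = {{u, v} | u v. u \<in> U \<and> v \<in> V}"

definition incidence_count :: "'a set set \<Rightarrow> 'a \<Rightarrow> nat" where
  "incidence_count p i = card {e \<in> p. i \<in> e}"

definition partition_weight :: "'a set set set \<Rightarrow> 'a \<Rightarrow> 'a \<Rightarrow> real" where
  "partition_weight P i j =
     (\<Sum>p\<in>P. real (incidence_count p i) * real (incidence_count p j) / real (card p))"

text \<open>The vertices are natural numbers because one cannot quantify over types inside a formula.
  As the sides are finite and the inequality is invariant under relabelling of vertices, this loses
  no generality. Finiteness of \<open>V\<close> is not implied by \<open>card V = k\<close> when \<open>k = 0\<close>. The parts of
  \<^const>\<open>partition_on\<close> are nonempty.\<close>

definition vempala_inequality :: "real \<Rightarrow> nat \<Rightarrow> nat \<Rightarrow> bool" where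
  "vempala_inequality C N k \<longleftrightarrow>
     (\<forall>(U :: nat set) (V :: nat set) P.
        finite U \<and> finite V \<and> U \<inter> V = {} \<and> card U = N \<and> card V = k \<and>
        partition_on (complete_bipartite_edges U V) P \<longrightarrow>
        (\<Sum>i\<in>U. \<Sum>j\<in>V. min 1 (partition_weight P i j)) \<ge> C * (real N * real k / ln (real N)))"

end

theory Submission
  imports Defs "HOL-Library.Countable"
begin

text \<open>The weight of a pair of vertices is multiplicative under tensor products: if the edges of
  \<open>K\<^sub>N\<^sub>,\<^sub>N\<close> and \<open>K\<^sub>M\<^sub>,\<^sub>M\<close> are coloured, colouring the edges of \<open>K\<^sub>N\<^sub>M\<^sub>,\<^sub>N\<^sub>M\<close> by pairs of colours multiplies
  degrees and class sizes, hence weights. Splitting \<open>K\<^sub>2\<^sub>,\<^sub>2\<close> into a path of three edges and a single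
  edge gives the weights \<open>4/3, 2/3, 2/3, 4/3\<close>, of average 1 but not constant, so
  \<open>\<Sum> sqrt w = 2 sqrt (4/3) + 2 sqrt (2/3) < 4\<close>. As \<open>min 1 w \<le> sqrt w\<close>, the \<open>n\<close>-th tensor power, for
  which \<open>N = 2 ^ n\<close>, has a truncated sum that is exponentially smaller in \<open>n\<close> than \<open>N\<^sup>2 = 4 ^ n\<close>.\<close>

text \<open>Indexing the sides by \<open>A\<close> and \<open>B\<close> through maps
  \<open>g\<close> and \<open>h\<close> lets both sides carry the same index set, here bit strings,
  while the vertices stay distinct.\<close>

definition color_class ::
  "('a \<Rightarrow> 'v) \<Rightarrow> ('b \<Rightarrow> 'v) \<Rightarrow> 'a set \<Rightarrow> 'b set \<Rightarrow> ('a \<Rightarrow> 'b \<Rightarrow> 'c) \<Rightarrow> 'c \<Rightarrow> 'v set set" where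
  "color_class g h A B f c = {{g a, h b} | a b. a \<in> A \<and> b \<in> B \<and> f a b = c}"

context
  fixes g :: "'a \<Rightarrow> 'v" and h :: "'b \<Rightarrow> 'v" and A :: "'a set" and B :: "'b set"
    and f :: "'a \<Rightarrow> 'b \<Rightarrow> 'c"
  assumes inj_g: "inj g" and inj_h: "inj h" and disj: "\<And>a b. g a \<noteq> h b"
begin

lemma edge_eq_iff: "{g a, h b} = {g a', h b'} \<longleftrightarrow> a = a' \<and> b = b'"
  \<comment> \<open>The disjoint ranges of \<open>g\<close> and \<open>h\<close> rule out the
    crossed matching of the two doubletons.\<close>
  using disj[of a b'] disj[of a' b] inj_g inj_h by (auto simp: doubleton_eq_iff inj_eq)

lemma incidence_count_color_class_left:
  assumes "a \<in> A"
  shows "incidence_count (color_class g h A B f c) (g a) = card {b \<in> B. f a b = c}"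
proof -
  have "{e \<in> color_class g h A B f c. g a \<in> e} = (\<lambda>b. {g a, h b}) ` {b \<in> B. f a b = c}"
    using assms disj inj_g by (auto simp: color_class_def inj_eq)
  moreover have "inj_on (\<lambda>b. {g a, h b}) {b \<in> B. f a b = c}"
    by (auto simp: inj_on_def edge_eq_iff)
  ultimately show ?thesis by (simp add: incidence_count_def card_image)
qed

lemma incidence_count_color_class_right:
  assumes "b \<in> B"
  shows "incidence_count (color_class g h A B f c) (h b) = card {a \<in> A. f a b = c}"
proof -
  have "{e \<in> color_class g h A B f c. h b \<in> e} = (\<lambda>a. {g a, h b}) ` {a \<in> A. f a b = c}"
    using assms disj[symmetric] inj_h by (auto simp: color_class_def inj_eq)
  moreover have "inj_on (\<lambda>a. {g a, h b}) {a \<in> A. f a b = c}"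
    by (auto simp: inj_on_def edge_eq_iff)
  ultimately show ?thesis by (simp add: incidence_count_def card_image)
qed

lemma card_color_class:
  "card (color_class g h A B f c) = card {(a, b) \<in> A \<times> B. f a b = c}"
proof -
  have "color_class g h A B f c = (\<lambda>(a, b). {g a, h b}) ` {(a, b) \<in> A \<times> B. f a b = c}"
    by (auto simp: color_class_def)
  moreover have "inj_on (\<lambda>(a, b). {g a, h b}) {(a, b) \<in> A \<times> B. f a b = c}"
    by (auto simp: inj_on_def edge_eq_iff)
  ultimately show ?thesis by (simp add: card_image)
qed

lemma disjoint_color_class:
  "c \<noteq> d \<Longrightarrow> color_class g h A B f c \<inter> color_class g h A B f d = {}"
  by (auto simp: color_class_def edge_eq_iff)

text \<open>Since \<open>C\<close> is the image of \<open>f\<close>, every colour occurs and no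
  class is empty.\<close>

lemma partition_on_color_class:
  assumes "C = (\<lambda>(a, b). f a b) ` (A \<times> B)"
  shows "partition_on (complete_bipartite_edges (g ` A) (h ` B)) (color_class g h A B f ` C)"
proof (rule partition_onI)
  show "\<Union> (color_class g h A B f ` C) = complete_bipartite_edges (g ` A) (h ` B)"
    using assms by (auto simp: color_class_def complete_bipartite_edges_def) blast+
  show "disjnt p q"
    if "p \<in> color_class g h A B f ` C" "q \<in> color_class g h A B f ` C" "p \<noteq> q" for p q
  proof -
    from that obtain c d where "p = color_class g h A B f c" "q = color_class g h A B f d" by blast
    then show ?thesis using that(3) disjoint_color_class[of c d] by (cases "c = d") (auto simp: disjnt_def)
  qed
  show "{} \<notin> color_class g h A B f ` C"
    using assms by (auto simp: color_class_def)
qed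

lemma partition_weight_color_class:
  assumes "C = (\<lambda>(a, b). f a b) ` (A \<times> B)" "a \<in> A" "b \<in> B"
  shows "partition_weight (color_class g h A B f ` C) (g a) (h b) =
    (\<Sum>c\<in>C. real (card {b \<in> B. f a b = c}) * real (card {a \<in> A. f a b = c})
        / real (card {(a, b) \<in> A \<times> B. f a b = c}))"
proof -
  have "color_class g h A B f c \<noteq> {}" if "c \<in> C" for c
    using that assms(1) by (auto simp: color_class_def)
  \<comment> \<open>Nonempty disjoint classes of different colours are different, so the sum over
    parts can be reindexed by colours.\<close>
  then have "inj_on (color_class g h A B f) C"
    using disjoint_color_class by (metis inf.idem inj_onI)
  then show ?thesis
    using assms(2,3) by (simp add: partition_weight_def sum.reindex card_color_class
        incidence_count_color_class_left incidence_count_color_class_right)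
qed

end

definition bool_lists :: "nat \<Rightarrow> bool list set" where
  "bool_lists n = {xs. length xs = n}"

lemma finite_bool_lists [simp]: "finite (bool_lists n)"
  using finite_lists_length_eq[of "UNIV :: bool set" n] by (simp add: bool_lists_def)

lemma card_bool_lists: "card (bool_lists n) = 2 ^ n"
  using card_lists_length_eq[of "UNIV :: bool set" n] by (simp add: bool_lists_def)

lemma bool_lists_0: "bool_lists 0 = {[]}"
  by (auto simp: bool_lists_def)

lemma bool_lists_Suc: "bool_lists (Suc n) = (\<lambda>(x, xs). x # xs) ` (UNIV \<times> bool_lists n)"
  by (auto simp: bool_lists_def length_Suc_conv)

lemma sum_bool_lists_Suc:
  fixes F :: "bool list \<Rightarrow> 'a :: comm_monoid_add"
  shows "sum F (bool_lists (Suc n)) = (\<Sum>x\<in>UNIV. \<Sum>xs\<in>bool_lists n. F (x # xs))"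
  by (simp add: bool_lists_Suc sum.reindex inj_on_def sum.cartesian_product case_prod_unfold)

text \<open>For one bit, the colour \<open>x \<and> y\<close> splits the four edges as required:
  \<open>True\<close> is the single edge, \<open>False\<close> the path of three edges. Acting
  coordinatewise gives the tensor power.\<close>

abbreviation map_and :: "bool list \<Rightarrow> bool list \<Rightarrow> bool list" where
  "map_and \<equiv> map2 (\<and>)"

lemma map_and_commute: "map_and xs ys = map_and ys xs"
  by (induction xs ys rule: list_induct2') auto

text \<open>Conjunction is idempotent, so each colour already appears on the diagonal.\<close>

lemma image_map_and: "(\<lambda>(xs, ys). map_and xs ys) ` (bool_lists n \<times> bool_lists n) = bool_lists n"
proof -
  have "map_and xs xs = xs" for xs by (induction xs) auto
  then have "xs \<in> (\<lambda>(xs, ys). map_and xs ys) ` (bool_lists n \<times> bool_lists n)"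
    if "xs \<in> bool_lists n" for xs
    using that by (intro image_eqI[of _ _ "(xs, xs)"]) auto
  then show ?thesis by (auto simp: bool_lists_def)
qed

definition and_degree :: "nat \<Rightarrow> bool list \<Rightarrow> bool list \<Rightarrow> nat" where
  "and_degree n xs c = card {ys \<in> bool_lists n. map_and xs ys = c}"

definition and_size :: "nat \<Rightarrow> bool list \<Rightarrow> nat" where
  "and_size n c = card {(xs, ys) \<in> bool_lists n \<times> bool_lists n. map_and xs ys = c}"

definition and_weight :: "nat \<Rightarrow> bool list \<Rightarrow> bool list \<Rightarrow> real" where
  "and_weight n xs ys =
     (\<Sum>c\<in>bool_lists n. real (and_degree n xs c) * real (and_degree n ys c) / real (and_size n c))"

text \<open>The head and the tail of \<open>ys\<close> are chosen independently, so the count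
  factors; the same holds for pairs in \<open>and_size_Cons\<close>.\<close>

lemma and_degree_Cons:
  "and_degree (Suc n) (x # xs) (c # cs) = card {y. (x \<and> y) = c} * and_degree n xs cs"
proof -
  have "{ys \<in> bool_lists (Suc n). map_and (x # xs) ys = c # cs} =
      (\<lambda>(y, ys). y # ys) ` ({y. (x \<and> y) = c} \<times> {ys \<in> bool_lists n. map_and xs ys = cs})"
    by (auto simp: bool_lists_Suc)
  then show ?thesis
    by (simp add: and_degree_def card_image inj_on_def card_cartesian_product)
qed

lemma and_size_Cons:
  "and_size (Suc n) (c # cs) = card {(x, y). (x \<and> y) = c} * and_size n cs"
proof -
  let ?S = "{(x, y). (x \<and> y) = c}"
  let ?T = "{(xs, ys) \<in> bool_lists n \<times> bool_lists n. map_and xs ys = cs}"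
  let ?j = "\<lambda>((x, y), (xs, ys)). (x # xs :: bool list, y # ys :: bool list)"
  have "{(xs, ys) \<in> bool_lists (Suc n) \<times> bool_lists (Suc n). map_and xs ys = c # cs} = ?j ` (?S \<times> ?T)"
    by (auto simp: bool_lists_Suc image_iff)
  moreover have "inj_on ?j (?S \<times> ?T)" by (auto simp: inj_on_def)
  ultimately show ?thesis
    by (simp add: and_size_def card_image card_cartesian_product)
qed

text \<open>The one-bit factor adds the contributions of the classes \<open>False\<close> (3 edges)
  and \<open>True\<close> (1 edge): two \<open>True\<close> ends give 1/3 + 1, two
  \<open>False\<close> ends give 2*2/3 + 0, and mixed ends give 2*1/3 + 0.\<close>

lemma and_weight_Cons:
  "and_weight (Suc n) (x # xs) (y # ys) = (if x = y then 4/3 else 2/3) * and_weight n xs ys"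
proof -
  have "{(x, y). (x \<and> y) = False} = {(False, False), (False, True), (True, False)}"
    "{(x, y). (x \<and> y) = True} = {(True, True)}" by auto
  then have size: "card {(x, y). (x \<and> y) = c} = (if c then 1 else 3)" for c
    by (cases c) simp_all
  have "{y. (x \<and> y) = c} = (if x then {c} else if c then {} else {False, True})" for x c by auto
  then have degree: "card {y. (x \<and> y) = c} = (if x then 1 else if c then 0 else 2)" for x c by simp
  show ?thesis
    unfolding and_weight_def sum_bool_lists_Suc and_degree_Cons and_size_Cons size degree
    by (simp add: UNIV_bool sum_distrib_left flip: sum.distrib)
       (auto intro!: sum.cong simp: field_simps)
qed

lemma and_weight_nonneg: "0 \<le> and_weight n xs ys"
  by (simp add: and_weight_def sum_nonneg)

text \<open>Unlike \<open>min 1\<close>, the square root is multiplicative, so the double sum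
  factors over the coordinates.\<close>

lemma sum_sqrt_and_weight_le:
  "(\<Sum>xs\<in>bool_lists n. \<Sum>ys\<in>bool_lists n. sqrt (and_weight n xs ys)) \<le> (99/25) ^ n"
proof (induction n)
  case 0
  have "{(xs, ys). xs = [] \<and> ys = []} = {([] :: bool list, [] :: bool list)}" by auto
  then show ?case
    by (simp add: bool_lists_0 and_weight_def and_degree_def and_size_def cong: conj_cong)
next
  case (Suc n)
  let ?S = "\<Sum>xs\<in>bool_lists n. \<Sum>ys\<in>bool_lists n. sqrt (and_weight n xs ys)"
  \<comment> \<open>These rational bounds are just sharp enough: 2 * 29/25 + 2 * 41/50 = 99/25,
    which is below 4.\<close>
  have "sqrt (4/3) \<le> 29/25"
    by (rule real_le_lsqrt) (simp_all add: power2_eq_square)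
  moreover have "sqrt (2/3) \<le> 41/50"
    by (rule real_le_lsqrt) (simp_all add: power2_eq_square)
  ultimately have *: "2 * sqrt (4/3) + 2 * sqrt (2/3) \<le> 99/25" by linarith
  have "(\<Sum>xs\<in>bool_lists (Suc n). \<Sum>ys\<in>bool_lists (Suc n). sqrt (and_weight (Suc n) xs ys))
      = (2 * sqrt (4/3) + 2 * sqrt (2/3)) * ?S"
    unfolding sum_bool_lists_Suc and_weight_Cons real_sqrt_mult
    by (simp add: UNIV_bool sum.distrib distrib_right flip: sum_distrib_left)
  also have "\<dots> \<le> 99/25 * (99/25) ^ n"
    by (intro mult_mono * Suc.IH) (auto intro!: sum_nonneg and_weight_nonneg)
  finally show ?case by simp
qed

lemma vempala_inequality_two_power_imp:
  assumes "vempala_inequality C (2 ^ n) (2 ^ n)"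
  shows "C * (4 ^ n / (real n * ln 2)) \<le> (99/25) ^ n"
proof -
  let ?L = "bool_lists n"
  \<comment> \<open>Even and odd codes make the two copies of the bit strings disjoint sets of
    naturals.\<close>
  define g h where "g xs = 2 * to_nat xs" and "h xs = 2 * to_nat xs + 1" for xs :: "bool list"
  have inj: "inj g" "inj h" by (auto simp: g_def h_def inj_on_def)
  have ne: "g xs \<noteq> h ys" for xs ys unfolding g_def h_def by presburger
  let ?P = "color_class g h ?L ?L map_and ` ?L"
  have card: "card (g ` ?L) = 2 ^ n" "card (h ` ?L) = 2 ^ n"
    using inj by (simp_all add: card_image inj_on_subset card_bool_lists)
  have weight: "partition_weight ?P (g xs) (h ys) = and_weight n xs ys"
    if "xs \<in> ?L" "ys \<in> ?L" for xs ys
  proof -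
    \<comment> \<open>By symmetry of the colouring, degrees on the right side are also given by
      \<open>and_degree\<close>.\<close>
    have "{xs \<in> ?L. map_and xs ys = c} = {xs \<in> ?L. map_and ys xs = c}" for c
      by (simp only: map_and_commute[of _ ys])
    then show ?thesis
      using partition_weight_color_class[OF inj ne image_map_and[symmetric] that]
      by (simp add: and_weight_def and_degree_def and_size_def)
  qed
  \<comment> \<open>If \<open>w \<le> 1\<close> then \<open>w \<le> sqrt w\<close>; otherwise
    \<open>1 \<le> sqrt w\<close>.\<close>
  have sqrt: "min 1 w \<le> sqrt w" if "0 \<le> w" for w :: real
    using that by (cases "w \<le> 1") (auto simp: min_def intro: real_le_rsqrt power_le_one
        simp: power2_eq_square mult_left_le)
  have "partition_on (complete_bipartite_edges (g ` ?L) (h ` ?L)) ?P"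
    by (rule partition_on_color_class[OF inj ne image_map_and[symmetric]])
  moreover have "g ` ?L \<inter> h ` ?L = {}" using ne by auto
  ultimately have "C * (real (2 ^ n) * real (2 ^ n) / ln (real (2 ^ n)))
      \<le> (\<Sum>i\<in>g ` ?L. \<Sum>j\<in>h ` ?L. min 1 (partition_weight ?P i j))"
    using assms[unfolded vempala_inequality_def, rule_format, of "g ` ?L" "h ` ?L" ?P] card by simp
  also have "\<dots> = (\<Sum>xs\<in>?L. \<Sum>ys\<in>?L. min 1 (and_weight n xs ys))"
    using inj by (simp add: sum.reindex inj_on_subset weight)
  also have "\<dots> \<le> (\<Sum>xs\<in>?L. \<Sum>ys\<in>?L. sqrt (and_weight n xs ys))"
    by (intro sum_mono sqrt and_weight_nonneg)
  also have "\<dots> \<le> (99/25) ^ n" by (rule sum_sqrt_and_weight_le)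
  finally show ?thesis by (simp add: ln_realpow flip: power_mult_distrib)
qed

text \<open>This refutes both claims at once, as \<open>k = N\<close> is allowed in the first. The
  logarithm of \<open>2 ^ n\<close> costs only a factor linear in \<open>n\<close>, which cannot
  offset the exponential decay of (99/25)^n / 4^n.\<close>

lemma not_vempala_inequality_balanced:
  assumes "0 < C"
  shows "\<exists>N\<ge>2. \<not> vempala_inequality C N N"
proof (rule ccontr)
  assume "\<not> ?thesis"
  then have ineq: "vempala_inequality C N N" if "2 \<le> N" for N using that by blast
  have "C / ln 2 \<le> real n * (99/100) ^ n" if "1 \<le> n" for n
  proof -
    \<comment> \<open>This is the condition \<open>2 \<le> N\<close> for
      \<open>N = 2 ^ n\<close>.\<close>
    have "(2::nat) ^ 1 \<le> 2 ^ n" using that by (intro power_increasing) auto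
    then have "C * (4 ^ n / (real n * ln 2)) \<le> (99/25) ^ n"
      by (intro vempala_inequality_two_power_imp ineq) simp
    moreover have "(99/25 :: real) ^ n = (99/100) ^ n * 4 ^ n"
      by (simp flip: power_mult_distrib)
    ultimately show ?thesis using that by (simp add: field_simps)
  qed
  moreover have "(\<lambda>n. real n * (99/100) ^ n) \<longlonglongrightarrow> 0"
    by (rule powser_times_n_limit_0) simp
  ultimately have "C / ln 2 \<le> 0"
    by (intro LIMSEQ_le_const) auto
  then show False using assms by (simp add: field_simps)
qed

theorem mainTheorem7:
  "\<not> (\<exists>C::real. C > 0 \<and> (\<forall>N k :: nat. k \<le> N \<and> 2 \<le> N \<longrightarrow> vempala_inequality C N k)) \<and>
   \<not> (\<exists>C::real. C > 0 \<and> (\<forall>N :: nat. 2 \<le> N \<longrightarrow> vempala_inequality C N N))"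
  using not_vempala_inequality_balanced by blast

end
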